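(* Consider a deep exponential family with observed variables $\bm y^{(0)}\in\mathbb R^{m_0}$ and $L$ layers of latent variables $\bm y^{(\ell)}\in\mathbb R^{m_\ell}$, $\ell=1,\dots,L$, with joint density $$p(\{\bm y^{(\ell)}\}_{\ell=0}^L)=\Big[\prod_{\ell=0}^{L-1}\prod_{i=1}^{m_\ell}p(y_i^{(\ell)}\mid\bm y^{(\ell+1)})\Big]\Big[\prod_{i=1}^{m_L}p(y_i^{(L)})\Big],$$ where $p(y_i^{(\ell)}\mid\bm y^{(\ell+1)})=\exp\{g(y_i^{(\ell)})+t(y_i^{(\ell)})\eta_i^{(\ell)}-a(\eta_i^{(\ell)})\}$ and $\eta_i^{(\ell)}=b_i^{(\ell)}+\bm w_i^{(\ell)}\cdot\bm y^{(\ell+1)}$, with $b_i^{(\ell)}\in\mathbb R$ and $\bm w_i^{(\ell)}=(w_{i1}^{(\ell)},\dots,w_{im_{\ell+1}}^{(\ell)})\in\mathbb R^{m_{\ell+1}}$. Let $q$ be a mean-field variational distribution on the latent variables given $\bm y^{(0)}$. For each $\ell\in\{0,\dots,L-1\}$ and $1\le i\le m_\ell$ let $\bm\varepsilon_i^{(\ell)}$ be in the probability simplex $\Delta^{m_{\ell+1}-1}$ (that is, $\varepsilon_{ij}^{(\ell)}\ge 0$ for all $j$ and $\sum_{j=1}^{m_{\ell+1}}\varepsilon_{ij}^{(\ell)}=1$) and let $\hat{\bm b}_i^{(\ell)}\in\mathbb R^{m_{\ell+1}}$ satisfy $\sum_{j=1}^{m_{\ell+1}}\varepsilon_{ij}^{(\ell)}\hat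 b_{ij}^{(\ell)}=b_i^{(\ell)}$. Define, for $1\le j\le m_{\ell+1}$, $$\hat\eta_{ij}^{(\ell)}=\hat b_{ij}^{(\ell)}+\frac{w_{ij}^{(\ell)}}{\varepsilon_{ij}^{(\ell)}}\,y_j^{(\ell+1)},\qquad \hat p(y_i^{(\ell)}\mid y_j^{(\ell+1)})=\exp\{g(y_i^{(\ell)})+t(y_i^{(\ell)})\hat\eta_{ij}^{(\ell)}-a(\hat\eta_{ij}^{(\ell)})\}.$$ Then $$\begin{aligned}\log p(\bm y^{(0)})\ \ge\ &\sum_{i=1}^{m_0}\sum_{j=1}^{m_1}\varepsilon_{ij}^{(0)}\,\mathbb E[\log\hat p(y_i^{(0)}\mid y_j^{(1)})]\\&+\sum_{\ell=1}^{L-1}\sum_{i=1}^{m_\ell}\Big(\sum_{j=1}^{m_{\ell+1}}\varepsilon_{ij}^{(\ell)}\,\mathbb E[\log\hat p(y_i^{(\ell)}\mid y_j^{(\ell+1)})]+H_q(y_i^{(\ell)}\mid\bm y^{(0)})\Big)\\&+\sum_{i=1}^{m_L}\Big(\mathbb E[\log p(y_i^{(L)})]+H_q(y_i^{(L)}\mid\bm y^{(0)})\Big).\end{aligned}$$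
   Context: An exponential family of densities has the form $p(x)=\exp\{g(x)+t(x)\eta-a(\eta)\}$, where $g$ is the log-base measure, $t$ the sufficient statistic, $\eta$ the natural parameter and $a$ the log-partition function, which is convex. $p(\bm y^{(0)})$ is the marginal density of the observed variables. A mean-field variational distribution has product form $q=\prod_{\ell=1}^L\prod_{i=1}^{m_\ell}q(y_i^{(\ell)}\mid\bm y^{(0)})$. Expectations $\mathbb E$ and the conditional entropies $H_q(y_i^{(\ell)}\mid\bm y^{(0)})$ are taken with respect to $q$.
   Formalization: Where ε_ij = 0 the quotient w_ij/ε_ij is undefined, so w_ij = 0 is required there and that term counts as zero; the natural parameters are assumed admissible almost everywhere, and the expectations and entropies in the bound are assumed to exist and be finite. *)

theory Defs
  imports "HOL-Probability.Probability"
begin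

text \<open>
  Densities are taken with respect to a dominating measure \<^term>\<open>\<nu>\<close> on the real line (Lebesgue
  measure, its restriction to a support, counting measure on the integers, ...).
\<close>

definition is_density :: "real measure \<Rightarrow> (real \<Rightarrow> real) \<Rightarrow> bool" where
  "is_density \<nu> f \<longleftrightarrow>
     f \<in> borel_measurable \<nu> \<and> (\<forall>x\<in>space \<nu>. 0 \<le> f x) \<and> (\<integral>\<^sup>+ x. ennreal (f x) \<partial>\<nu>) = 1"

definition natural_params :: "real measure \<Rightarrow> (real \<Rightarrow> real) \<Rightarrow> (real \<Rightarrow> real) \<Rightarrow> real set" where
  "natural_params \<nu> g t = {\<eta>. integrable \<nu> (\<lambda>x. exp (g x + t x * \<eta>))}"

text \<open>Meaningful for \<^term>\<open>\<eta> \<in> natural_params \<nu> g t\<close> only.\<close>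

definition log_partition :: "real measure \<Rightarrow> (real \<Rightarrow> real) \<Rightarrow> (real \<Rightarrow> real) \<Rightarrow> real \<Rightarrow> real" where
  "log_partition \<nu> g t \<eta> = ln (\<integral>x. exp (g x + t x * \<eta>) \<partial>\<nu>)"

definition expfam_density ::
  "real measure \<Rightarrow> (real \<Rightarrow> real) \<Rightarrow> (real \<Rightarrow> real) \<Rightarrow> real \<Rightarrow> real \<Rightarrow> real" where
  "expfam_density \<nu> g t \<eta> x = exp (g x + t x * \<eta> - log_partition \<nu> g t \<eta>)"

text \<open>
  A configuration \<^term>\<open>y :: nat \<times> nat \<Rightarrow> real\<close> assigns to \<^term>\<open>(l, i)\<close> the value of the \<^term>\<open>i\<close>-th
  variable of layer \<^term>\<open>l\<close>, for \<^term>\<open>i \<in> {1..m l}\<close>; layer 0 is observed.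
\<close>

definition latent_vars :: "nat \<Rightarrow> (nat \<Rightarrow> nat) \<Rightarrow> (nat \<times> nat) set" where
  "latent_vars L m = (SIGMA l:{1..L}. {1..m l})"

definition with_observed :: "(nat \<Rightarrow> real) \<Rightarrow> (nat \<times> nat \<Rightarrow> real) \<Rightarrow> nat \<times> nat \<Rightarrow> real" where
  "with_observed y0 z = (\<lambda>(l, i). if l = 0 then y0 i else z (l, i))"

definition eta ::
  "(nat \<Rightarrow> nat) \<Rightarrow> (nat \<Rightarrow> nat \<Rightarrow> real) \<Rightarrow> (nat \<Rightarrow> nat \<Rightarrow> nat \<Rightarrow> real) \<Rightarrow>
   nat \<Rightarrow> nat \<Rightarrow> (nat \<times> nat \<Rightarrow> real) \<Rightarrow> real" where
  "eta m b w l i y = b l i + (\<Sum>j = 1..m (l + 1). w l i j * y (l + 1, j))"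

definition joint_density ::
  "real measure \<Rightarrow> (real \<Rightarrow> real) \<Rightarrow> (real \<Rightarrow> real) \<Rightarrow> (nat \<Rightarrow> real \<Rightarrow> real) \<Rightarrow>
   nat \<Rightarrow> (nat \<Rightarrow> nat) \<Rightarrow> (nat \<Rightarrow> nat \<Rightarrow> real) \<Rightarrow> (nat \<Rightarrow> nat \<Rightarrow> nat \<Rightarrow> real) \<Rightarrow>
   (nat \<times> nat \<Rightarrow> real) \<Rightarrow> real" where
  "joint_density \<nu> g t pL L m b w y =
     (\<Prod>l = 0..<L. \<Prod>i = 1..m l. expfam_density \<nu> g t (eta m b w l i y) (y (l, i))) *
     (\<Prod>i = 1..m L. pL i (y (L, i)))"

text \<open>The integral may be infinite for exceptional values of \<^term>\<open>y0\<close>.\<close>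

definition marginal_density ::
  "real measure \<Rightarrow> (real \<Rightarrow> real) \<Rightarrow> (real \<Rightarrow> real) \<Rightarrow> (nat \<Rightarrow> real \<Rightarrow> real) \<Rightarrow>
   nat \<Rightarrow> (nat \<Rightarrow> nat) \<Rightarrow> (nat \<Rightarrow> nat \<Rightarrow> real) \<Rightarrow> (nat \<Rightarrow> nat \<Rightarrow> nat \<Rightarrow> real) \<Rightarrow>
   (nat \<Rightarrow> real) \<Rightarrow> ennreal" where
  "marginal_density \<nu> g t pL L m b w y0 =
     (\<integral>\<^sup>+ z. ennreal (joint_density \<nu> g t pL L m b w (with_observed y0 z))
        \<partial>(\<Pi>\<^sub>M v\<in>latent_vars L m. \<nu>))"

definition ln_ennreal :: "ennreal \<Rightarrow> ereal" where
  "ln_ennreal x = (if x = 0 then -\<infinity> else if x = \<top> then \<infinity> else ereal (ln (enn2real x)))"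

text \<open>\<^term>\<open>q l i\<close> is the density of the \<^term>\<open>i\<close>-th variable of layer \<^term>\<open>l\<close>, given the observed values.\<close>

definition mean_field :: "real measure \<Rightarrow> nat \<Rightarrow> (nat \<Rightarrow> nat) \<Rightarrow> (nat \<Rightarrow> nat \<Rightarrow> real \<Rightarrow> real) \<Rightarrow>
   (nat \<times> nat \<Rightarrow> real) measure" where
  "mean_field \<nu> L m q =
     density (\<Pi>\<^sub>M v\<in>latent_vars L m. \<nu>)
       (\<lambda>z. ennreal (\<Prod>l = 1..L. \<Prod>i = 1..m l. q l i (z (l, i))))"

text \<open>
  For \<^term>\<open>\<epsilon> l i j = 0\<close> the quotient below is 0 in HOL; this is used only together with
  \<^term>\<open>w l i j = 0\<close>.
\<close>

definition eta_hat ::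
  "(nat \<Rightarrow> nat \<Rightarrow> nat \<Rightarrow> real) \<Rightarrow> (nat \<Rightarrow> nat \<Rightarrow> nat \<Rightarrow> real) \<Rightarrow> (nat \<Rightarrow> nat \<Rightarrow> nat \<Rightarrow> real) \<Rightarrow>
   nat \<Rightarrow> nat \<Rightarrow> nat \<Rightarrow> (nat \<times> nat \<Rightarrow> real) \<Rightarrow> real" where
  "eta_hat bh w \<epsilon> l i j y = bh l i j + w l i j / \<epsilon> l i j * y (l + 1, j)"

definition p_hat ::
  "real measure \<Rightarrow> (real \<Rightarrow> real) \<Rightarrow> (real \<Rightarrow> real) \<Rightarrow>
   (nat \<Rightarrow> nat \<Rightarrow> nat \<Rightarrow> real) \<Rightarrow> (nat \<Rightarrow> nat \<Rightarrow> nat \<Rightarrow> real) \<Rightarrow> (nat \<Rightarrow> nat \<Rightarrow> nat \<Rightarrow> real) \<Rightarrow>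
   nat \<Rightarrow> nat \<Rightarrow> nat \<Rightarrow> (nat \<times> nat \<Rightarrow> real) \<Rightarrow> real" where
  "p_hat \<nu> g t bh w \<epsilon> l i j y = expfam_density \<nu> g t (eta_hat bh w \<epsilon> l i j y) (y (l, i))"

end

theory Submission
  imports Defs
begin

text \<open>
  Since each \<^term>\<open>\<eta>\<close> is the \<^term>\<open>\<epsilon>\<close>-mixture of the natural parameters with one parent, convexity of
  the log-partition function bounds each conditional log-density from below by the mixture of the
  log-densities with one parent. This lower bound of the log-joint, minus the log-density of the
  mean-field distribution \<^term>\<open>Q\<close>, is a \<^term>\<open>Q\<close>-integrable function \<^term>\<open>G\<close>, and the marginal density is
  at least \<open>E\<^sub>Q (exp G)\<close>, hence at least \<open>exp (E\<^sub>Q G)\<close> by Jensen. Working with \<^term>\<open>G\<close> instead of the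
  log-joint avoids any integrability or measurability requirement on the latter.
\<close>

section \<open>Convexity of the log-partition function\<close>

lemma integral_exp_pos:
  fixes f :: "'a \<Rightarrow> real"
  assumes "integrable M (\<lambda>x. exp (f x))" "emeasure M (space M) \<noteq> 0"
  shows "0 < (\<integral>x. exp (f x) \<partial>M)"
proof -
  have "(\<integral>x. exp (f x) \<partial>M) \<noteq> 0"
  proof
    assume "(\<integral>x. exp (f x) \<partial>M) = 0"
    then have "AE x in M. exp (f x) = 0"
      using integral_nonneg_eq_0_iff_AE[OF assms(1)] by simp
    then have "AE x in M. False" by simp
    then show False using assms(2) by (simp add: AE_iff_null null_setsD1)
  qed
  moreover have "0 \<le> (\<integral>x. exp (f x) \<partial>M)" by simp
  ultimately show ?thesis by linarith
qed

lemma exp_weighted_sum_le: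
  fixes c x :: "'a \<Rightarrow> real"
  assumes "finite J" "\<And>j. j \<in> J \<Longrightarrow> 0 \<le> c j" "sum c J = 1"
  shows "exp (\<Sum>j\<in>J. c j * x j) \<le> (\<Sum>j\<in>J. c j * exp (x j))"
proof -
  have "J \<noteq> {}" using assms(3) by auto
  then show ?thesis
    using convex_on_sum[OF assms(1) _ exp_convex assms(3), of x] assms(2) by simp
qed

text \<open>Each \<open>exp (g x + t x * \<theta> j - ?a (\<theta> j))\<close> is a normalized
  density. Their geometric mean with weights \<open>c\<close> is
  \<open>exp (g x + t x * ?\<eta> - ?s)\<close>, because the weights sum to 1. It lies below their
  arithmetic mean, whose integral is 1, so the integral at \<open>?\<eta>\<close> is at most
  \<open>exp ?s\<close>; taking logarithms gives the claim.\<close>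

lemma log_partition_convex:
  fixes c \<theta> :: "'a \<Rightarrow> real"
  assumes J: "finite J" "\<And>j. j \<in> J \<Longrightarrow> 0 \<le> c j" "sum c J = 1"
    and \<theta>: "\<And>j. j \<in> J \<Longrightarrow> \<theta> j \<in> natural_params \<nu> g t"
    and mean: "(\<Sum>j\<in>J. c j * \<theta> j) \<in> natural_params \<nu> g t"
    and nu: "emeasure \<nu> (space \<nu>) \<noteq> 0"
  shows "log_partition \<nu> g t (\<Sum>j\<in>J. c j * \<theta> j) \<le> (\<Sum>j\<in>J. c j * log_partition \<nu> g t (\<theta> j))"
proof -
  let ?a = "log_partition \<nu> g t" and ?\<eta> = "\<Sum>j\<in>J. c j * \<theta> j"
  let ?s = "\<Sum>j\<in>J. c j * ?a (\<theta> j)"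
  have int: "integrable \<nu> (\<lambda>x. exp (g x + t x * \<theta> j))" if "j \<in> J" for j
    using \<theta>[OF that] by (simp add: natural_params_def)
  have int': "integrable \<nu> (\<lambda>x. exp (g x + t x * ?\<eta>))"
    using mean by (simp add: natural_params_def)
  \<comment> \<open>Positivity of the integral makes \<open>exp (- ?a (\<theta> j))\<close> its
    reciprocal; at 0 the logarithm would only have a default value.\<close>
  have normalized: "(\<integral>x. exp (g x + t x * \<theta> j) * exp (- ?a (\<theta> j)) \<partial>\<nu>) = 1" if "j \<in> J" for j
    using integral_exp_pos[OF int[OF that] nu] by (simp add: log_partition_def exp_minus)
  \<comment> \<open>Integrating the pointwise inequality replaces Hoelder: each normalized density on the right integrates to 1.\<close>
  have pointwise: "exp (g x + t x * ?\<eta>) * exp (- ?s) \<le>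
      (\<Sum>j\<in>J. c j * (exp (g x + t x * \<theta> j) * exp (- ?a (\<theta> j))))" for x
  proof -
    have "g x + t x * ?\<eta> - ?s = (\<Sum>j\<in>J. c j * (g x + t x * \<theta> j - ?a (\<theta> j)))"
    proof -
      have "(\<Sum>j\<in>J. c j * (g x + t x * \<theta> j - ?a (\<theta> j))) =
        (\<Sum>j\<in>J. c j) * g x + t x * ?\<eta> - ?s"
        by (simp add: sum_distrib_left sum_distrib_right algebra_simps sum.distrib sum_subtractf)
      then show ?thesis by (simp add: J(3))
    qed
    then have "exp (g x + t x * ?\<eta> - ?s) \<le> (\<Sum>j\<in>J. c j * exp (g x + t x * \<theta> j - ?a (\<theta> j)))"
      using exp_weighted_sum_le[OF J] by simp
    then show ?thesis by (simp add: exp_diff exp_minus divide_inverse)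
  qed
  have "(\<integral>x. exp (g x + t x * ?\<eta>) \<partial>\<nu>) * exp (- ?s) = (\<integral>x. exp (g x + t x * ?\<eta>) * exp (- ?s) \<partial>\<nu>)"
    by simp
  also have "\<dots> \<le> (\<integral>x. (\<Sum>j\<in>J. c j * (exp (g x + t x * \<theta> j) * exp (- ?a (\<theta> j)))) \<partial>\<nu>)"
    by (intro integral_mono pointwise integrable_mult_left integrable_mult_right
        Bochner_Integration.integrable_sum int int')
  also have "\<dots> = (\<Sum>j\<in>J. c j * (\<integral>x. exp (g x + t x * \<theta> j) * exp (- ?a (\<theta> j)) \<partial>\<nu>))"
    by (subst Bochner_Integration.integral_sum)
      (auto intro!: integrable_mult_left integrable_mult_right int)
  also have "\<dots> = 1" using J(3) normalized by simp
  finally have "(\<integral>x. exp (g x + t x * ?\<eta>) \<partial>\<nu>) \<le> exp ?s"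
    by (simp add: exp_minus field_simps)
  then have "ln (\<integral>x. exp (g x + t x * ?\<eta>) \<partial>\<nu>) \<le> ln (exp ?s)"
    using integral_exp_pos[OF int' nu] by (subst ln_le_cancel_iff) auto
  then show ?thesis by (simp add: log_partition_def)
qed

text \<open>The exponent is affine in the natural parameter except for the log-partition term.
  Averaging with weights of sum 1 therefore preserves \<open>g x\<close> and the \<open>t x\<close>
  part, and the two sides differ only by the convexity gap of \<open>log_partition\<close>, which
  enters with a minus sign.\<close>

lemma ln_expfam_density_mixture:
  fixes c \<theta> :: "'a \<Rightarrow> real"
  assumes J: "finite J" "\<And>j. j \<in> J \<Longrightarrow> 0 \<le> c j" "sum c J = 1"
    and \<theta>: "\<And>j. j \<in> J \<Longrightarrow> \<theta> j \<in> natural_params \<nu> g t"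
    and mean: "(\<Sum>j\<in>J. c j * \<theta> j) \<in> natural_params \<nu> g t"
    and nu: "emeasure \<nu> (space \<nu>) \<noteq> 0"
  shows "(\<Sum>j\<in>J. c j * ln (expfam_density \<nu> g t (\<theta> j) x))
    \<le> ln (expfam_density \<nu> g t (\<Sum>j\<in>J. c j * \<theta> j) x)"
proof -
  have "(\<Sum>j\<in>J. c j * (g x + t x * \<theta> j - log_partition \<nu> g t (\<theta> j))) =
    (\<Sum>j\<in>J. c j) * g x + t x * (\<Sum>j\<in>J. c j * \<theta> j) - (\<Sum>j\<in>J. c j * log_partition \<nu> g t (\<theta> j))"
    by (simp add: sum_distrib_left sum_distrib_right algebra_simps sum.distrib sum_subtractf)
  then show ?thesis
    using log_partition_convex[OF J \<theta> mean nu] by (simp add: expfam_density_def J(3))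
qed

section \<open>Jensen's inequality for \<open>exp\<close> and the extended logarithm\<close>

lemma (in prob_space) exp_expectation_le_nn_integral:
  fixes G :: "'a \<Rightarrow> real"
  assumes G: "integrable M G"
  shows "ennreal (exp (expectation G)) \<le> (\<integral>\<^sup>+ x. ennreal (exp (G x)) \<partial>M)"
proof (cases "integrable M (\<lambda>x. exp (G x))")
  case True
  \<comment> \<open>the tangent line of \<open>exp\<close> at the mean\<close>
  have "exp (expectation G) = (\<integral>x. exp (expectation G) * (1 + (G x - expectation G)) \<partial>M)"
    using G by (simp add: prob_space)
  also have "\<dots> \<le> (\<integral>x. exp (G x) \<partial>M)"
  proof (rule integral_mono)
    fix x
    have "exp (expectation G) * (1 + (G x - expectation G))
      \<le> exp (expectation G) * exp (G x - expectation G)"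
      by (intro mult_left_mono exp_ge_add_one_self) simp
    then show "exp (expectation G) * (1 + (G x - expectation G)) \<le> exp (G x)"
      by (simp flip: exp_add)
  qed (use G True in auto)
  finally show ?thesis
    using True by (simp add: nn_integral_eq_integral ennreal_leI)
next
  \<comment> \<open>Since \<open>G\<close> is measurable and \<open>exp\<close> positive, failure of
    integrability can only mean that the right-hand side is infinite.\<close>
  case False
  have [measurable]: "G \<in> borel_measurable M" using G by auto
  have "(\<integral>\<^sup>+ x. ennreal (exp (G x)) \<partial>M) = \<infinity>"
    using False by (simp add: integrable_iff_bounded) (simp add: less_top[symmetric])
  then show ?thesis by simp
qed

text \<open>The bound \<open>exp r > 0\<close> excludes the argument 0, and an infinite argument
  makes the claim trivial. This lets the final estimate cover an infinite marginal density.\<close>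

lemma ereal_le_ln_ennreal:
  assumes "ennreal (exp r) \<le> x"
  shows "ereal r \<le> ln_ennreal x"
proof (cases x)
  case (real s)
  then have "exp r \<le> s" using assms by simp
  then have "0 < s" using exp_gt_zero[of r] by linarith
  moreover have "r \<le> ln s" using \<open>exp r \<le> s\<close> \<open>0 < s\<close> by (simp add: ln_ge_iff)
  ultimately show ?thesis using real by (simp add: ln_ennreal_def)
qed (simp add: ln_ennreal_def)

section \<open>Densities and their finite products\<close>

lemma emeasure_space_nonzero:
  assumes "is_density \<nu> f"
  shows "emeasure \<nu> (space \<nu>) \<noteq> 0"
proof
  assume "emeasure \<nu> (space \<nu>) = 0"
  then have "AE x in \<nu>. False" by (simp add: trivial_limit_def flip: ae_filter_eq_bot_iff)
  then have "AE x in \<nu>. ennreal (f x) = 0" by eventually_elim simp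
  then have "(\<integral>\<^sup>+ x. ennreal (f x) \<partial>\<nu>) = (\<integral>\<^sup>+ x. 0 \<partial>\<nu>)" by (rule nn_integral_cong_AE)
  then show False using assms by (simp add: is_density_def)
qed

text \<open>By Tonelli the integral of a product of functions of single coordinates factorizes, and
  every factor other than that of \<open>v\<close> is 1. The same computation yields the total mass
  and the marginals of a product density.\<close>

lemma emeasure_density_prod_vimage:
  fixes \<nu> :: "real measure" and f :: "'i \<Rightarrow> real \<Rightarrow> real"
  assumes nu: "sigma_finite_measure \<nu>" and I: "finite I"
    and f: "\<And>i. i \<in> I \<Longrightarrow> is_density \<nu> (f i)"
    and v: "v \<in> I" and A: "A \<in> sets \<nu>"
  shows "emeasure (density (\<Pi>\<^sub>M i\<in>I. \<nu>) (\<lambda>z. ennreal (\<Prod>i\<in>I. f i (z i))))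
      ((\<lambda>z. z v) -` A \<inter> space (\<Pi>\<^sub>M i\<in>I. \<nu>)) = (\<integral>\<^sup>+ x. ennreal (f v x) * indicator A x \<partial>\<nu>)"
proof -
  interpret product_sigma_finite "\<lambda>_. \<nu>" using nu by (simp add: product_sigma_finite_def)
  have meas[measurable]: "f i \<in> borel_measurable \<nu>" if "i \<in> I" for i
    using f[OF that] by (simp add: is_density_def)
  let ?P = "\<Pi>\<^sub>M i\<in>I. \<nu>"
  \<comment> \<open>The indicator of the cylinder over \<open>A\<close> is absorbed into the factor
    of coordinate \<open>v\<close>, so that the integrand stays a product over coordinates.\<close>
  let ?h = "\<lambda>i x. ennreal (f i x) * (if i = v then indicator A x else 1)"
  have [measurable]: "(\<lambda>z. z i) \<in> measurable ?P \<nu>" if "i \<in> I" for i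
    using that by (rule measurable_component_singleton)
  have [measurable]: "(\<lambda>z. ennreal (\<Prod>i\<in>I. f i (z i))) \<in> borel_measurable ?P"
    by measurable
  have B: "(\<lambda>z. z v) -` A \<inter> space ?P \<in> sets ?P"
    using v A by (intro measurable_sets[OF measurable_component_singleton]) auto
  have "emeasure (density ?P (\<lambda>z. ennreal (\<Prod>i\<in>I. f i (z i)))) ((\<lambda>z. z v) -` A \<inter> space ?P)
    = (\<integral>\<^sup>+ z. ennreal (\<Prod>i\<in>I. f i (z i)) * indicator ((\<lambda>z. z v) -` A \<inter> space ?P) z \<partial>?P)"
    using B by (simp add: emeasure_density)
  also have "\<dots> = (\<integral>\<^sup>+ z. (\<Prod>i\<in>I. ?h i (z i)) \<partial>?P)"
  proof (rule nn_integral_cong)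
    fix z assume z: "z \<in> space ?P"
    have nonneg: "0 \<le> f i (z i)" if "i \<in> I" for i
      using f[OF that] z that by (auto simp: is_density_def space_PiM)
    have "(\<Prod>i\<in>I. ?h i (z i)) = (\<Prod>i\<in>I. ennreal (f i (z i))) * indicator A (z v)"
      using I v by (simp add: prod.distrib prod.delta)
    also have "\<dots> = ennreal (\<Prod>i\<in>I. f i (z i)) * indicator A (z v)"
      using nonneg by (simp add: prod_ennreal)
    finally show "ennreal (\<Prod>i\<in>I. f i (z i)) * indicator ((\<lambda>z. z v) -` A \<inter> space ?P) z
      = (\<Prod>i\<in>I. ?h i (z i))"
      using z by (simp add: indicator_def)
  qed
  also have "\<dots> = (\<Prod>i\<in>I. \<integral>\<^sup>+ x. ?h i x \<partial>\<nu>)"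
    using I A by (intro product_nn_integral_prod) auto
  also have "\<dots> = (\<integral>\<^sup>+ x. ?h v x \<partial>\<nu>) * (\<Prod>i\<in>I - {v}. \<integral>\<^sup>+ x. ?h i x \<partial>\<nu>)"
    using I v by (rule prod.remove)
  also have "(\<Prod>i\<in>I - {v}. \<integral>\<^sup>+ x. ?h i x \<partial>\<nu>) = 1"
    using f by (intro prod.neutral) (auto simp: is_density_def)
  finally show ?thesis by simp
qed

text \<open>For nonempty \<open>I\<close> this is the cylinder over the whole line of any
  coordinate. The empty index set, which offers no coordinate, is treated apart: the product measure
  is then a point mass and the empty product is 1.\<close>

lemma prob_space_density_prod:
  fixes \<nu> :: "real measure" and f :: "'i \<Rightarrow> real \<Rightarrow> real"
  assumes nu: "sigma_finite_measure \<nu>" and I: "finite I"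
    and f: "\<And>i. i \<in> I \<Longrightarrow> is_density \<nu> (f i)"
  shows "prob_space (density (\<Pi>\<^sub>M i\<in>I. \<nu>) (\<lambda>z. ennreal (\<Prod>i\<in>I. f i (z i))))"
proof (cases "I = {}")
  case True
  then show ?thesis
    by (intro prob_spaceI) (simp add: emeasure_density PiM_empty)
next
  case False
  then obtain v where v: "v \<in> I" by auto
  have "(\<lambda>z. z v) -` space \<nu> \<inter> space (\<Pi>\<^sub>M i\<in>I. \<nu>) = space (\<Pi>\<^sub>M i\<in>I. \<nu>)"
    using v by (auto simp: space_PiM)
  then show ?thesis
    using emeasure_density_prod_vimage[OF nu I f v sets.top] f[OF v]
    by (intro prob_spaceI) (simp add: is_density_def cong: nn_integral_cong)
qed

text \<open>This turns expectations of a function of one latent variable, and its entropy, into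
  integrals over \<open>\<nu>\<close>.\<close>

lemma distributed_density_prod:
  fixes \<nu> :: "real measure" and f :: "'i \<Rightarrow> real \<Rightarrow> real"
  assumes nu: "sigma_finite_measure \<nu>" and I: "finite I"
    and f: "\<And>i. i \<in> I \<Longrightarrow> is_density \<nu> (f i)" and v: "v \<in> I"
  shows "distributed (density (\<Pi>\<^sub>M i\<in>I. \<nu>) (\<lambda>z. ennreal (\<Prod>i\<in>I. f i (z i)))) \<nu> (\<lambda>z. z v) (f v)"
proof -
  let ?Q = "density (\<Pi>\<^sub>M i\<in>I. \<nu>) (\<lambda>z. ennreal (\<Prod>i\<in>I. f i (z i)))"
  have comp: "(\<lambda>z. z v) \<in> measurable ?Q \<nu>"
    using v by simp
  have meas: "(\<lambda>x. ennreal (f v x)) \<in> borel_measurable \<nu>"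
    using f[OF v] by (simp add: is_density_def)
  have "distr ?Q \<nu> (\<lambda>z. z v) = density \<nu> (\<lambda>x. ennreal (f v x))"
    using emeasure_density_prod_vimage[OF nu I f v] meas comp
    by (intro measure_eqI) (auto simp: emeasure_distr emeasure_density)
  then show ?thesis using comp meas by (simp add: distributed_def)
qed

theorem mainTheorem2:
  fixes \<nu> :: "real measure" and g t :: "real \<Rightarrow> real"
    and L :: nat and m :: "nat \<Rightarrow> nat"
    and b :: "nat \<Rightarrow> nat \<Rightarrow> real" and w :: "nat \<Rightarrow> nat \<Rightarrow> nat \<Rightarrow> real"
    and pL :: "nat \<Rightarrow> real \<Rightarrow> real" and y0 :: "nat \<Rightarrow> real"
    and q :: "nat \<Rightarrow> nat \<Rightarrow> real \<Rightarrow> real" and Q :: "(nat \<times> nat \<Rightarrow> real) measure"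
    and \<epsilon> bh :: "nat \<Rightarrow> nat \<Rightarrow> nat \<Rightarrow> real"
  assumes nu: "sigma_finite_measure \<nu>" "sets \<nu> = sets borel"
    and g_t: "g \<in> borel_measurable borel" "t \<in> borel_measurable borel"
    and L: "1 \<le> L"
    and eta: "\<And>l i. l < L \<Longrightarrow> i \<in> {1..m l} \<Longrightarrow>
      AE z in (\<Pi>\<^sub>M v\<in>latent_vars L m. \<nu>). eta m b w l i z \<in> natural_params \<nu> g t"
    and pL: "\<And>i. i \<in> {1..m L} \<Longrightarrow> is_density \<nu> (pL i)"
    and q: "\<And>l i. l \<in> {1..L} \<Longrightarrow> i \<in> {1..m l} \<Longrightarrow> is_density \<nu> (q l i)"
    and Q: "Q = mean_field \<nu> L m q"
    and eps_nonneg: "\<And>l i j. l < L \<Longrightarrow> i \<in> {1..m l} \<Longrightarrow> j \<in> {1..m (l + 1)} \<Longrightarrow> 0 \<le> \<epsilon> l i j"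
    and eps_sum: "\<And>l i. l < L \<Longrightarrow> i \<in> {1..m l} \<Longrightarrow> (\<Sum>j = 1..m (l + 1). \<epsilon> l i j) = 1"
    and eps_zero: "\<And>l i j. l < L \<Longrightarrow> i \<in> {1..m l} \<Longrightarrow> j \<in> {1..m (l + 1)} \<Longrightarrow>
      \<epsilon> l i j = 0 \<Longrightarrow> w l i j = 0"
    and bh: "\<And>l i. l < L \<Longrightarrow> i \<in> {1..m l} \<Longrightarrow> (\<Sum>j = 1..m (l + 1). \<epsilon> l i j * bh l i j) = b l i"
    and eta_hat: "\<And>l i j. l < L \<Longrightarrow> i \<in> {1..m l} \<Longrightarrow> j \<in> {1..m (l + 1)} \<Longrightarrow> 0 < \<epsilon> l i j \<Longrightarrow>
      AE z in Q. eta_hat bh w \<epsilon> l i j z \<in> natural_params \<nu> g t"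
    and finite_phat: "\<And>l i j. l < L \<Longrightarrow> i \<in> {1..m l} \<Longrightarrow> j \<in> {1..m (l + 1)} \<Longrightarrow> 0 < \<epsilon> l i j \<Longrightarrow>
      integrable Q (\<lambda>z. ln (p_hat \<nu> g t bh w \<epsilon> l i j (with_observed y0 z)))"
    and finite_pL: "\<And>i. i \<in> {1..m L} \<Longrightarrow> AE z in Q. 0 < pL i (z (L, i))"
      "\<And>i. i \<in> {1..m L} \<Longrightarrow> integrable Q (\<lambda>z. ln (pL i (z (L, i))))"
    and finite_H: "\<And>l i. l \<in> {1..L} \<Longrightarrow> i \<in> {1..m l} \<Longrightarrow> integrable \<nu> (\<lambda>x. q l i x * ln (q l i x))"
  shows "ln_ennreal (marginal_density \<nu> g t pL L m b w y0) \<ge> ereal (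
    (\<Sum>i = 1..m 0. \<Sum>j = 1..m 1.
       \<epsilon> 0 i j * (\<integral>z. ln (p_hat \<nu> g t bh w \<epsilon> 0 i j (with_observed y0 z)) \<partial>Q))
    + (\<Sum>l = 1..L - 1. \<Sum>i = 1..m l.
       (\<Sum>j = 1..m (l + 1).
          \<epsilon> l i j * (\<integral>z. ln (p_hat \<nu> g t bh w \<epsilon> l i j (with_observed y0 z)) \<partial>Q))
       + prob_space.entropy Q (exp 1) \<nu> (\<lambda>z. z (l, i)))
    + (\<Sum>i = 1..m L.
       (\<integral>z. ln (pL i (z (L, i))) \<partial>Q) + prob_space.entropy Q (exp 1) \<nu> (\<lambda>z. z (L, i))))"
proof -

  \<comment> \<open>Notation and the mean-field distribution as a probability space\<close>
  define V where "V = latent_vars L m"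
  define P where "P = (\<Pi>\<^sub>M v\<in>V. \<nu>)"
  define d where "d z = (\<Prod>v\<in>V. q (fst v) (snd v) (z v))" for z :: "nat \<times> nat \<Rightarrow> real"
  \<comment> \<open>Only parents of positive weight are kept: for the others neither integrability
    nor an admissible natural parameter is assumed.\<close>
  define J where "J l i = {j \<in> {1..m (l + 1)}. 0 < \<epsilon> l i j}" for l i
  define lp where "lp l i j z = ln (p_hat \<nu> g t bh w \<epsilon> l i j (with_observed y0 z))" for l i j z
  define S where "S l i z = (\<Sum>j\<in>J l i. \<epsilon> l i j * lp l i j z)" for l i z
  \<comment> \<open>The last sum is \<open>ln (d z)\<close> wherever all factors of \<open>d\<close>
    are positive. It cancels the density in \<open>d z * exp (G z)\<close>, and its expectation
    produces the entropies.\<close>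
  define G where "G z = (\<Sum>l = 0..<L. \<Sum>i = 1..m l. S l i z) + (\<Sum>i = 1..m L. ln (pL i (z (L, i))))
    - (\<Sum>v\<in>V. ln (q (fst v) (snd v) (z v)))" for z
  define H where "H l i = prob_space.entropy Q (exp 1) \<nu> (\<lambda>z. z (l, i))" for l i
  define joint where "joint z = joint_density \<nu> g t pL L m b w (with_observed y0 z)" for z
  have space_nu: "space \<nu> = UNIV" using sets_eq_imp_space_eq[OF nu(2)] by simp
  have V_fin: "finite V" by (simp add: V_def latent_vars_def)
  have sum_V: "(\<Sum>v\<in>V. f (fst v) (snd v)) = (\<Sum>l = 1..L. \<Sum>i = 1..m l. f l i)"
    for f :: "nat \<Rightarrow> nat \<Rightarrow> real"
    by (simp add: V_def latent_vars_def sum.Sigma case_prod_beta)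
  have q_V: "is_density \<nu> (q (fst v) (snd v))" if "v \<in> V" for v
    using that by (auto simp: V_def latent_vars_def intro: q)
  have Q_eq: "Q = density P (\<lambda>z. ennreal (d z))"
    by (simp add: Q mean_field_def P_def d_def V_def latent_vars_def prod.Sigma case_prod_beta)
  have dist: "distributed Q \<nu> (\<lambda>z. z v) (q (fst v) (snd v))" if "v \<in> V" for v
    using distributed_density_prod[OF nu(1) V_fin q_V that] by (simp add: Q_eq P_def d_def)
  interpret Q: prob_space Q
    using prob_space_density_prod[OF nu(1) V_fin q_V] by (simp add: Q_eq P_def d_def)
  \<comment> \<open>Base \<open>exp 1\<close> measures entropy in natural units, so the logarithm in
    it is \<open>ln\<close>.\<close>
  interpret Q: information_space Q "exp 1" by unfold_locales simp
  have q_meas: "q (fst v) (snd v) \<in> borel_measurable \<nu>" if "v \<in> V" for v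
    using q_V[OF that] by (simp add: is_density_def)
  have q_nonneg: "0 \<le> q (fst v) (snd v) x" if "v \<in> V" for v x
    using q_V[OF that] by (simp add: is_density_def space_nu)
  have d_meas: "(\<lambda>z. ennreal (d z)) \<in> borel_measurable P"
  proof -
    have "(\<lambda>z. q (fst v) (snd v) (z v)) \<in> borel_measurable P" if "v \<in> V" for v
      unfolding P_def
      by (rule measurable_compose[OF measurable_component_singleton[OF that] q_meas[OF that]])
    then have "d \<in> borel_measurable P" unfolding d_def[abs_def] by (rule borel_measurable_prod)
    then show ?thesis by measurable
  qed
  \<comment> \<open>Used in both directions: assumptions over the product measure, such as
    \<open>eta\<close>, pass to \<open>Q\<close>, and the pointwise bound on the joint density
    passes back to \<open>P\<close>.\<close>
  have AE_Q: "(AE z in Q. R z) \<longleftrightarrow> (AE z in P. 0 < d z \<longrightarrow> R z)" for R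
    using AE_density[OF d_meas, of R] unfolding Q_eq by simp

  \<comment> \<open>Integrability and expectation of \<open>G\<close>\<close>
  have ln_q_int: "integrable Q (\<lambda>z. ln (q (fst v) (snd v) (z v)))"
    and entropy_eq: "H (fst v) (snd v) = - (\<integral>z. ln (q (fst v) (snd v) (z v)) \<partial>Q)"
    if v: "v \<in> V" for v
  proof -
    have meas: "(\<lambda>x. ln (q (fst v) (snd v) x)) \<in> borel_measurable \<nu>"
      using q_meas[OF v] by measurable
    have "integrable \<nu> (\<lambda>x. q (fst v) (snd v) x * ln (q (fst v) (snd v) x))"
      using v by (intro finite_H) (auto simp: V_def latent_vars_def)
    then show "integrable Q (\<lambda>z. ln (q (fst v) (snd v) (z v)))"
      using distributed_integrable[OF dist[OF v] meas q_nonneg[OF v]] by simp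
    \<comment> \<open>Up to sign, both sides are the integral of \<open>q ln q\<close> over
      \<open>\<nu>\<close>.\<close>
    show "H (fst v) (snd v) = - (\<integral>z. ln (q (fst v) (snd v) (z v)) \<partial>Q)"
      using Q.entropy_distr[OF dist[OF v] q_nonneg[OF v]]
        distributed_integral[OF dist[OF v] meas q_nonneg[OF v]]
      by (simp add: H_def log_def)
  qed
  have lp_int: "integrable Q (lp l i j)" if "l < L" "i \<in> {1..m l}" "j \<in> J l i" for l i j
    using finite_phat[of l i j] that by (simp add: lp_def[abs_def] J_def)
  have S_int: "integrable Q (S l i)" if "l < L" "i \<in> {1..m l}" for l i
    unfolding S_def[abs_def]
    by (intro Bochner_Integration.integrable_sum integrable_mult_right lp_int that)
  have S_expectation: "(\<integral>z. S l i z \<partial>Q) = (\<Sum>j = 1..m (l + 1). \<epsilon> l i j * (\<integral>z. lp l i j z \<partial>Q))"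
    if "l < L" "i \<in> {1..m l}" for l i
  proof -
    have "(\<integral>z. S l i z \<partial>Q) = (\<Sum>j\<in>J l i. \<epsilon> l i j * (\<integral>z. lp l i j z \<partial>Q))"
      unfolding S_def using lp_int[OF that]
      by (subst Bochner_Integration.integral_sum) auto
    \<comment> \<open>Parents outside \<open>J l i\<close> have weight 0, so their terms vanish
      whatever value the integral takes, including its default when the integrand is not
      integrable.\<close>
    also have "\<dots> = (\<Sum>j = 1..m (l + 1). \<epsilon> l i j * (\<integral>z. lp l i j z \<partial>Q))"
      using eps_nonneg[OF that] by (intro sum.mono_neutral_left) (force simp: J_def)+
    finally show ?thesis .
  qed
  have G_int: "integrable Q G"
    unfolding G_def[abs_def] using S_int finite_pL(2) ln_q_int
    by (intro Bochner_Integration.integrable_diff Bochner_Integration.integrable_add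
        Bochner_Integration.integrable_sum) auto
  have G_expectation: "(\<integral>z. G z \<partial>Q) =
    (\<Sum>l = 0..<L. \<Sum>i = 1..m l. \<Sum>j = 1..m (l + 1). \<epsilon> l i j * (\<integral>z. lp l i j z \<partial>Q))
    + (\<Sum>i = 1..m L. \<integral>z. ln (pL i (z (L, i))) \<partial>Q) + (\<Sum>l = 1..L. \<Sum>i = 1..m l. H l i)"
  proof -
    have "(\<integral>z. G z \<partial>Q) = (\<Sum>l = 0..<L. \<Sum>i = 1..m l. \<integral>z. S l i z \<partial>Q)
      + (\<Sum>i = 1..m L. \<integral>z. ln (pL i (z (L, i))) \<partial>Q)
      - (\<Sum>v\<in>V. \<integral>z. ln (q (fst v) (snd v) (z v)) \<partial>Q)"
    proof -
      have layer_int: "integrable Q (\<lambda>z. \<Sum>i = 1..m l. S l i z)" if "l < L" for l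
        using S_int[OF that] by (intro Bochner_Integration.integrable_sum) auto
      then have "integrable Q (\<lambda>z. \<Sum>l = 0..<L. \<Sum>i = 1..m l. S l i z)"
        by (rule Bochner_Integration.integrable_sum) simp
      moreover have "integrable Q (\<lambda>z. \<Sum>i = 1..m L. ln (pL i (z (L, i))))"
        using finite_pL(2) by (intro Bochner_Integration.integrable_sum) auto
      moreover have "integrable Q (\<lambda>z. \<Sum>v\<in>V. ln (q (fst v) (snd v) (z v)))"
        using ln_q_int by (intro Bochner_Integration.integrable_sum) auto
      moreover have "(\<integral>z. (\<Sum>l = 0..<L. \<Sum>i = 1..m l. S l i z) \<partial>Q)
        = (\<Sum>l = 0..<L. \<Sum>i = 1..m l. \<integral>z. S l i z \<partial>Q)"
        using layer_int S_int by (simp add: Bochner_Integration.integral_sum)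
      moreover have "(\<integral>z. (\<Sum>i = 1..m L. ln (pL i (z (L, i)))) \<partial>Q)
        = (\<Sum>i = 1..m L. \<integral>z. ln (pL i (z (L, i))) \<partial>Q)"
        using finite_pL(2) by (intro Bochner_Integration.integral_sum) auto
      moreover have "(\<integral>z. (\<Sum>v\<in>V. ln (q (fst v) (snd v) (z v))) \<partial>Q)
        = (\<Sum>v\<in>V. \<integral>z. ln (q (fst v) (snd v) (z v)) \<partial>Q)"
        using ln_q_int by (intro Bochner_Integration.integral_sum) auto
      ultimately show ?thesis unfolding G_def by simp
    qed
    moreover have "(\<Sum>v\<in>V. \<integral>z. ln (q (fst v) (snd v) (z v)) \<partial>Q) = - (\<Sum>v\<in>V. H (fst v) (snd v))"
      using entropy_eq by (simp add: sum_negf)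
    ultimately show ?thesis by (simp add: S_expectation sum_V)
  qed

  \<comment> \<open>Pointwise comparison with the joint density\<close>
  have S_le: "AE z in Q. S l i z
      \<le> ln (expfam_density \<nu> g t (eta m b w l i (with_observed y0 z)) (with_observed y0 z (l, i)))"
    if li: "l < L" "i \<in> {1..m l}" for l i
  proof -
    have J_subset: "J l i \<subseteq> {1..m (l + 1)}" by (auto simp: J_def)
    have eps_J: "\<epsilon> l i j = 0" if "j \<in> {1..m (l + 1)} - J l i" for j
      using eps_nonneg[OF li, of j] that by (force simp: J_def)
    have J_sum: "sum (\<epsilon> l i) (J l i) = 1"
      using eps_sum[OF li] sum.mono_neutral_left[OF _ J_subset, of "\<epsilon> l i"] eps_J by simp
    \<comment> \<open>Weights of sum 1 force a parent to exist. Its variable lies in layer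
      \<open>l + 1 \<ge> 1\<close>, hence is latent, and its variational density shows that
      \<open>\<nu>\<close> is not the zero measure.\<close>
    then obtain j where "j \<in> J l i" by (cases "J l i = {}") auto
    then have "(l + 1, j) \<in> V" using li by (auto simp: V_def latent_vars_def J_def)
    from q_V[OF this] have nu_nonzero: "emeasure \<nu> (space \<nu>) \<noteq> 0"
      by (rule emeasure_space_nonzero)
    have mix: "(\<Sum>j\<in>J l i. \<epsilon> l i j * eta_hat bh w \<epsilon> l i j y) = eta m b w l i y" for y
    proof -
      have "(\<Sum>j\<in>J l i. \<epsilon> l i j * eta_hat bh w \<epsilon> l i j y)
        = (\<Sum>j = 1..m (l + 1). \<epsilon> l i j * eta_hat bh w \<epsilon> l i j y)"
        using J_subset eps_J by (intro sum.mono_neutral_left) auto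
      also have "\<dots> = (\<Sum>j = 1..m (l + 1). \<epsilon> l i j * bh l i j + w l i j * y (l + 1, j))"
      proof (intro sum.cong refl)
        \<comment> \<open>For positive weight the factor cancels the quotient in
          \<open>eta_hat\<close>. For weight 0 the left side is 0, and \<open>eps_zero\<close> makes
          the right side 0 as well.\<close>
        fix j assume "j \<in> {1..m (l + 1)}"
        then show "\<epsilon> l i j * eta_hat bh w \<epsilon> l i j y = \<epsilon> l i j * bh l i j + w l i j * y (l + 1, j)"
          using eps_zero[OF li] by (cases "\<epsilon> l i j = 0") (auto simp: eta_hat_def distrib_left)
      qed
      also have "\<dots> = eta m b w l i y" by (simp only: sum.distrib bh[OF li] eta_def)
      finally show ?thesis .
    qed
    \<comment> \<open>Both parameters read layer \<open>l + 1\<close> only, while inserting the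
      observed values changes layer 0 only.\<close>
    have eta_obs: "eta m b w l i (with_observed y0 z) = eta m b w l i z"
      and eta_hat_obs: "eta_hat bh w \<epsilon> l i j (with_observed y0 z) = eta_hat bh w \<epsilon> l i j z" for z j
      by (simp_all add: eta_def eta_hat_def with_observed_def)
    have "AE z in Q. eta m b w l i z \<in> natural_params \<nu> g t"
      unfolding AE_Q P_def V_def using eta[OF li] by eventually_elim simp
    moreover have "AE z in Q. \<forall>j\<in>J l i. eta_hat bh w \<epsilon> l i j z \<in> natural_params \<nu> g t"
      using eta_hat[OF li] by (intro AE_finite_allI) (auto simp: J_def)
    ultimately show ?thesis
    proof eventually_elim
      case (elim z)
      have "(\<Sum>j\<in>J l i. \<epsilon> l i j * ln (expfam_density \<nu> g t (eta_hat bh w \<epsilon> l i j z)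
            (with_observed y0 z (l, i))))
        \<le> ln (expfam_density \<nu> g t (\<Sum>j\<in>J l i. \<epsilon> l i j * eta_hat bh w \<epsilon> l i j z)
            (with_observed y0 z (l, i)))"
        using elim J_sum nu_nonzero finite_subset[OF J_subset]
        by (intro ln_expfam_density_mixture) (simp_all add: mix, simp add: J_def)
      then show ?case by (simp add: S_def lp_def p_hat_def eta_hat_obs eta_obs mix)
    qed
  qed
  have "AE z in Q. d z * exp (G z) \<le> joint z"
  proof -
    have "AE z in Q. 0 < d z" unfolding AE_Q by simp
    moreover have "AE z in Q. \<forall>i\<in>{1..m L}. 0 < pL i (z (L, i))"
      using finite_pL(1) by (intro AE_finite_allI) auto
    moreover have "AE z in Q. \<forall>l\<in>{0..<L}. \<forall>i\<in>{1..m l}. S l i z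
      \<le> ln (expfam_density \<nu> g t (eta m b w l i (with_observed y0 z)) (with_observed y0 z (l, i)))"
      using S_le by (intro AE_finite_allI) auto
    ultimately show ?thesis
    proof eventually_elim
      case (elim z)
      have q_pos: "0 < q (fst v) (snd v) (z v)" if "v \<in> V" for v
      proof -
        have "q (fst v) (snd v) (z v) \<noteq> 0"
          using elim(1) that V_fin prod_zero_iff[of V "\<lambda>v. q (fst v) (snd v) (z v)"]
          by (auto simp: d_def simp del: prod_zero_iff)
        then show ?thesis using q_nonneg[OF that, of "z v"] by linarith
      qed
      \<comment> \<open>Undoing \<open>ln\<close> requires positive arguments. For \<open>q\<close>
        and \<open>pL\<close> this holds only \<open>Q\<close>-almost everywhere; exponential family
        densities are positive everywhere.\<close>
      have d_exp: "d z = exp (\<Sum>v\<in>V. ln (q (fst v) (snd v) (z v)))"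
        using q_pos V_fin by (simp add: d_def exp_sum)
      have pL_exp: "(\<Prod>i = 1..m L. pL i (z (L, i))) = exp (\<Sum>i = 1..m L. ln (pL i (z (L, i))))"
        using elim(2) by (simp add: exp_sum)
      have "exp (\<Sum>l = 0..<L. \<Sum>i = 1..m l. S l i z)
        \<le> exp (\<Sum>l = 0..<L. \<Sum>i = 1..m l. ln (expfam_density \<nu> g t
            (eta m b w l i (with_observed y0 z)) (with_observed y0 z (l, i))))"
        using elim(3) unfolding exp_le_cancel_iff by (intro sum_mono) blast
      also have "\<dots> = (\<Prod>l = 0..<L. \<Prod>i = 1..m l. expfam_density \<nu> g t
            (eta m b w l i (with_observed y0 z)) (with_observed y0 z (l, i)))"
        by (simp add: exp_sum expfam_density_def)
      finally have "exp (\<Sum>l = 0..<L. \<Sum>i = 1..m l. S l i z) * (\<Prod>i = 1..m L. pL i (z (L, i)))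
        \<le> \<dots> * (\<Prod>i = 1..m L. pL i (z (L, i)))"
        by (rule mult_right_mono) (simp only: pL_exp exp_ge_zero)
      \<comment> \<open>\<open>L \<ge> 1\<close> ensures that the top layer is not the observed one,
        so \<open>with_observed\<close> leaves the arguments of \<open>pL\<close> unchanged.\<close>
      also have "\<dots> = joint z"
        using L by (simp add: joint_def joint_density_def with_observed_def)
      finally have "exp (\<Sum>l = 0..<L. \<Sum>i = 1..m l. S l i z) * (\<Prod>i = 1..m L. pL i (z (L, i)))
        \<le> joint z" .
      moreover have "d z * exp (G z) =
        exp (\<Sum>l = 0..<L. \<Sum>i = 1..m l. S l i z) * (\<Prod>i = 1..m L. pL i (z (L, i)))"
        unfolding d_exp G_def pL_exp by (simp flip: exp_add)
      ultimately show ?case by simp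
    qed
  qed
  \<comment> \<open>where \<open>d\<close> vanishes the left-hand side is 0, so the bound passes from \<open>Q\<close> to \<open>P\<close>\<close>
  then have joint_ge: "AE z in P. ennreal (d z) * ennreal (exp (G z)) \<le> ennreal (joint z)"
    unfolding AE_Q
  proof eventually_elim
    case (elim z)
    show ?case
      using elim by (cases "0 < d z") (auto simp: ennreal_neg ennreal_leI simp flip: ennreal_mult)
  qed

  \<comment> \<open>From Jensen's inequality to the evidence bound\<close>
  have "ennreal (exp (\<integral>z. G z \<partial>Q)) \<le> (\<integral>\<^sup>+ z. ennreal (exp (G z)) \<partial>Q)"
    by (rule Q.exp_expectation_le_nn_integral[OF G_int])
  also have "\<dots> = (\<integral>\<^sup>+ z. ennreal (d z) * ennreal (exp (G z)) \<partial>P)"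
  proof -
    have "G \<in> borel_measurable P" using G_int by (auto simp: Q_eq dest: borel_measurable_integrable)
    then show ?thesis
      unfolding Q_eq by (intro nn_integral_density d_meas) measurable
  qed
  also have "\<dots> \<le> (\<integral>\<^sup>+ z. ennreal (joint z) \<partial>P)"
    by (rule nn_integral_mono_AE[OF joint_ge])
  also have "\<dots> = marginal_density \<nu> g t pL L m b w y0"
    by (simp add: marginal_density_def joint_def P_def V_def)
  finally have "ereal (\<integral>z. G z \<partial>Q) \<le> ln_ennreal (marginal_density \<nu> g t pL L m b w y0)"
    by (rule ereal_le_ln_ennreal)
  \<comment> \<open>The conditional terms run over layers 0 to \<open>L - 1\<close> and the
    entropies over 1 to \<open>L\<close>. Splitting off layer 0 from the former and layer
    \<open>L\<close> from the latter leaves the common range of the middle sum.\<close>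
  moreover have "{0..<L} = insert 0 {1..L - 1}" "{1..L} = insert L {1..L - 1}"
    using L by auto
  ultimately show ?thesis
    using L unfolding G_expectation lp_def H_def
    by (simp add: sum.distrib add_ac)
qed

end
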